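(* Let $d>0$. There exists a constant $D$, depending only on $d$ and on the integer $p$, such that for every $f\in F_{d,p,\Gamma}$, with $\Gamma=[-1,1]$, $$E_{\hat P_X}(f)\le\left(1+\|I_p\|\left(1+D\,\frac{\left(\sum_{k=1}^{n-m}w_k\right)^{1/2}}{\min_{j=0,\ldots,p}\sqrt{\tilde w_j}}\,(p+1)^{-p}\right)\right)E_p(\hat f)\,\|\omega_m\|_\infty .$$
   Context: For $n\in\mathbb{N}$, $X_n=\{x_{i,n}=-1+\tfrac{2i}{n} : i=0,\ldots,n\}$. Let $m=\lfloor \tfrac{\pi}{\sqrt2}\sqrt n\rfloor$ and $x_j^{CL}=-\cos(\tfrac{\pi}{m}j)$, $j=0,\ldots,m$ (Chebyshev-Lobatto nodes). The mock-Chebyshev subset $X'_m=\{x'_{0,m}<\cdots<x'_{m,m}\}\subset X_n$ consists of the nodes of $X_n$ nearest to the $m+1$ Chebyshev-Lobatto nodes; $n$ is assumed large enough that $m<n$ and the constructions below make sense, and these $m+1$ nodes are distinct. $X''_{n-m}=X_n\setminus X'_m=\{x''_{1,n-m}<\cdots<x''_{n-m,n-m}\}$. Put $\omega_m(t)=\prod_{i=0}^m(t-x'_{i,m})$ and $w_k=\omega_m^2(x''_{k,n-m})$, $k=1,\ldots,n-m$. Let $q=n/6$ and $p=\lfloor\tfrac{\pi}{\sqrt2}\sqrt q\rfloor$. $\tilde X''_{n-m}\subset X''_{n-m}$ is a set of $q$ nodes of $X''_{n-m}$ approximating the equispaced grid $z_k=-1+\tfrac{2k-1}{q}$, $k=1,\ldots,q$,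 and $X'''_p=\{x'''_{j,p}\}_{j=0}^p\subset\tilde X''_{n-m}$ is its mock-Chebyshev subset, i.e. a set of $p+1$ distinct nodes of $\tilde X''_{n-m}$ close to the $p+1$ Chebyshev nodes. $\tilde w_j=\omega_m^2(x'''_{j,p})$, $j=0,\ldots,p$, are the weights at these nodes. $I_p\varphi$ is the polynomial of degree $\le p$ interpolating $\varphi$ on $X'''_p$, and $\|I_p\|$ is the norm of $I_p$ as an operator on $C[-1,1]$ with the uniform norm. $\mathcal{P}^s$ is the space of real polynomials of degree $\le s$, and $E_p(\varphi)=\min_{Q\in\mathcal{P}^p}\|\varphi-Q\|_\infty$, with $\|\cdot\|_\infty$ the uniform norm on $[-1,1]$. For $k\in\mathbb{N}$, $d>0$, $F_{d,k,\Gamma}=\{\varphi\in C^k[-1,1] : \|\varphi^{(k)}\|_\infty\le d\}$. With $r=m+p+1$, the constrained mock-Chebyshev least-squares polynomial $\hat P_X=\hat P_Xf$ of $f$ is the unique minimizer of $\sum_{k=1}^{n-m}(f-P)^2(x''_{k,n-m})$ over $P\in\mathcal{P}^r$ with $P(x'_{i,m})=f(x'_{i,m})$, $i=0,\ldots,m$; and $E_{\hat P_X}(f)=\|f-\hat P_X\|_\infty$. $P_{X'}$ is the polynomial of degree $\le m$ interpolating $f$ on $X'_m$, and $\hat f(t)=\dfrac{f(t)-P_{X'}(t)}{\omega_m(t)}$, $t\in[-1,1]$ (extended by continuity at the nodes of $X'_m$). *)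

theory Defs
  imports "HOL-Analysis.Analysis" "HOL-Computational_Algebra.Polynomial"
begin

subsection \<open>Uniform norm, smoothness classes, best approximation, interpolation on [-1,1]\<close>

definition supnorm :: "(real \<Rightarrow> real) \<Rightarrow> real" where
  "supnorm \<phi> = (SUP t\<in>{-1..1}. \<bar>\<phi> t\<bar>)"

text \<open>Derivatives are taken within [-1,1], so they are one-sided at the end points.\<close>

primrec deriv_iter :: "nat \<Rightarrow> (real \<Rightarrow> real) \<Rightarrow> real \<Rightarrow> real" where
  "deriv_iter 0 \<phi> = \<phi>"
| "deriv_iter (Suc k) \<phi> = (\<lambda>t. vector_derivative (deriv_iter k \<phi>) (at t within {-1..1}))"

definition C_k :: "nat \<Rightarrow> (real \<Rightarrow> real) set" where
  "C_k k = {\<phi>. (\<forall>i<k. deriv_iter i \<phi> differentiable_on {-1..1}) \<and>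
               continuous_on {-1..1} (deriv_iter k \<phi>)}"

definition F_class :: "real \<Rightarrow> nat \<Rightarrow> (real \<Rightarrow> real) set" where
  "F_class d k = {\<phi> \<in> C_k k. supnorm (deriv_iter k \<phi>) \<le> d}"

text \<open>For continuous functions on [-1,1] the infimum is attained, i.e. it is a minimum.\<close>

definition best_approx_err :: "nat \<Rightarrow> (real \<Rightarrow> real) \<Rightarrow> real" where
  "best_approx_err s \<phi> = (INF Q\<in>{Q :: real poly. degree Q \<le> s}. supnorm (\<lambda>t. \<phi> t - poly Q t))"

text \<open>Intended for sets \<open>S\<close> of exactly \<open>s + 1\<close> nodes, where the polynomial exists and is unique.\<close>

definition interp_poly :: "nat \<Rightarrow> real set \<Rightarrow> (real \<Rightarrow> real) \<Rightarrow> real poly" where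
  "interp_poly s S \<phi> = (THE P. degree P \<le> s \<and> (\<forall>x\<in>S. poly P x = \<phi> x))"

text \<open>Operator norm with respect to the uniform norm on C[-1,1].\<close>

definition interp_norm :: "nat \<Rightarrow> real set \<Rightarrow> real" where
  "interp_norm s S =
     (SUP \<phi>\<in>{\<phi>. continuous_on {-1..1} \<phi> \<and> supnorm \<phi> \<le> 1}. supnorm (poly (interp_poly s S \<phi>)))"

subsection \<open>Nodes\<close>

definition mock_m :: "nat \<Rightarrow> nat" where
  "mock_m n = nat \<lfloor>pi / sqrt 2 * sqrt (real n)\<rfloor>"

text \<open>The number \<open>q = n / 6\<close> of nodes, rounded down when 6 does not divide \<open>n\<close>;
  in the formula for \<open>p\<close> the real number \<open>n / 6\<close> is used.\<close>

definition mock_q :: "nat \<Rightarrow> nat" where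
  "mock_q n = n div 6"

definition mock_p :: "nat \<Rightarrow> nat" where
  "mock_p n = nat \<lfloor>pi / sqrt 2 * sqrt (real n / 6)\<rfloor>"

definition equi_nodes :: "nat \<Rightarrow> real set" where
  "equi_nodes n = (\<lambda>i. - 1 + 2 * real i / real n) ` {0..n}"

definition cheb_lobatto :: "nat \<Rightarrow> nat \<Rightarrow> real" where
  "cheb_lobatto m j = - cos (pi / real m * real j)"

definition mid_grid :: "nat \<Rightarrow> nat \<Rightarrow> real" where
  "mid_grid q k = - 1 + (2 * real k - 1) / real q"

text \<open>\<open>X'\<close> consists of \<open>m + 1\<close> distinct points of \<open>X\<close>, the \<open>j\<close>-th being a nearest point of
  \<open>X\<close> to the \<open>j\<close>-th Chebyshev-Lobatto node. When two points of \<open>X\<close> are equally near,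
  either choice is admitted.\<close>

definition mock_chebyshev :: "real set \<Rightarrow> nat \<Rightarrow> real set \<Rightarrow> bool" where
  "mock_chebyshev X m X' \<longleftrightarrow>
     (\<exists>x'. strict_mono_on {0..m} x' \<and> X' = x' ` {0..m} \<and>
        (\<forall>j\<in>{0..m}. x' j \<in> X \<and>
           (\<forall>x\<in>X. \<bar>x' j - cheb_lobatto m j\<bar> \<le> \<bar>x - cheb_lobatto m j\<bar>)))"

text \<open>\<open>Y\<close> consists of distinct nodes of \<open>X\<close>, indexed increasingly by \<open>I\<close>, which approximate
  the reference nodes \<open>z\<close> with accuracy \<open>\<delta>\<close>. No particular accuracy is prescribed, so \<open>\<delta>\<close> is
  arbitrary; this also covers other choices of Chebyshev reference nodes than the Lobatto ones.\<close>

definition approx_nodes :: "real \<Rightarrow> real set \<Rightarrow> nat set \<Rightarrow> (nat \<Rightarrow> real) \<Rightarrow> real set \<Rightarrow> bool" where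
  "approx_nodes \<delta> X I z Y \<longleftrightarrow>
     (\<exists>y. strict_mono_on I y \<and> Y = y ` I \<and> (\<forall>i\<in>I. y i \<in> X \<and> \<bar>y i - z i\<bar> \<le> \<delta>))"

definition nodal :: "real set \<Rightarrow> real \<Rightarrow> real" where
  "nodal X' t = (\<Prod>x\<in>X'. t - x)"

subsection \<open>Constrained mock-Chebyshev least squares\<close>

definition constrained_polys :: "nat \<Rightarrow> real set \<Rightarrow> (real \<Rightarrow> real) \<Rightarrow> real poly set" where
  "constrained_polys r X' f = {P. degree P \<le> r \<and> (\<forall>x\<in>X'. poly P x = f x)}"

definition cmcls :: "nat \<Rightarrow> real set \<Rightarrow> real set \<Rightarrow> (real \<Rightarrow> real) \<Rightarrow> real poly" where
  "cmcls r X' X'' f =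
     (THE P. is_arg_min (\<lambda>P. \<Sum>x\<in>X''. (f x - poly P x)\<^sup>2) (\<lambda>P. P \<in> constrained_polys r X' f) P)"

text \<open>The quotient \<open>(f - P_X') / \<omega>_m\<close>, extended by continuity at the nodes of \<open>X'\<close>.\<close>

definition f_hat :: "nat \<Rightarrow> real set \<Rightarrow> (real \<Rightarrow> real) \<Rightarrow> real \<Rightarrow> real" where
  "f_hat m X' f t =
     (let g = (\<lambda>s. (f s - poly (interp_poly m X' f) s) / nodal X' s)
      in if t \<in> X' then Lim (at t within {-1..1}) g else g t)"

end

theory Submission
  imports Defs
begin

text \<open>
  Write \<open>\<omega>\<close> for the nodal polynomial of \<open>X'\<close> and \<open>g\<close> for the quotient of \<open>f - P\<close> by \<open>\<omega>\<close>, where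
  \<open>P\<close> interpolates \<open>f\<close> on \<open>X'\<close>. The polynomials admitted in the constrained problem are exactly
  those of the form \<open>P + \<omega> R\<close> with \<open>R\<close> of degree at most \<open>p\<close>, and at a node \<open>x\<close> of \<open>X''\<close> the
  squared residual is \<open>\<omega>(x)\<^sup>2 (g(x) - R(x))\<^sup>2\<close>. So the optimal \<open>R\<close> is the discrete least-squares
  approximation of \<open>g\<close> with weights \<open>\<omega>(x)\<^sup>2\<close> (\<open>cmcls_decomposition\<close>), and the error of the
  constrained polynomial is \<open>\<omega> (g - R)\<close>.

  It remains to compare \<open>R\<close> with an arbitrary \<open>Q\<close> of degree at most \<open>p\<close>. Put
  \<open>e = \<parallel>g - Q\<parallel>\<close>. The root of the weighted sum of squares is no larger for \<open>R\<close> than for \<open>Q\<close>,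
  where it is at most \<open>e \<surd>(\<Sum>w)\<close>; a single term of a sum of squares is bounded by the whole sum, so at each
  interpolation node \<open>\<bar>g - R\<bar>\<close> is at most \<open>e \<surd>(\<Sum>w)\<close> divided by the root of the weight there.
  Adding \<open>\<bar>g - Q\<bar> \<le> e\<close> bounds \<open>R - Q\<close> at the nodes, and since interpolation reproduces
  \<open>R - Q\<close>, its uniform norm exceeds that bound by at most the factor \<open>\<parallel>I\<^sub>p\<parallel>\<close>
  (\<open>abs_poly_le_interp_norm\<close>, \<open>least_squares_uniform_error\<close>). Taking the infimum over \<open>Q\<close> gives the
  asserted bound with \<open>1\<close> in place of \<open>D (p+1)^(-p)\<close>. As \<open>D\<close> may depend on \<open>p\<close>,
  the choice \<open>D = (p+1)^p\<close> makes the two agree.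

  These estimates need \<open>g\<close> to be bounded, which is where the smoothness of \<open>f\<close> enters: for
  \<open>p \<ge> 1\<close> the function \<open>f\<close> is differentiable, so \<open>g\<close> extends continuously to the zeros of \<open>\<omega>\<close>
  (\<open>f_hat_continuous\<close>), and \<open>m < n\<close> forces \<open>p \<ge> 1\<close> (\<open>mock_p_pos\<close>).
\<close>

section \<open>Uniform norm\<close>

lemma abs_le_supnorm:
  assumes "continuous_on {-1..1} \<phi>" "t \<in> {-1..1}"
  shows "\<bar>\<phi> t\<bar> \<le> supnorm \<phi>"
  unfolding supnorm_def
proof (rule cSUP_upper)
  have "compact ((\<lambda>t. \<bar>\<phi> t\<bar>) ` {-1..1})"
    using assms(1) by (intro compact_continuous_image continuous_intros) auto
  then show "bdd_above ((\<lambda>t. \<bar>\<phi> t\<bar>) ` {-1..1})"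
    by (intro bounded_imp_bdd_above compact_imp_bounded)
qed fact

lemma supnorm_le:
  assumes "\<And>t. t \<in> {-1..1} \<Longrightarrow> \<bar>\<phi> t\<bar> \<le> M"
  shows "supnorm \<phi> \<le> M"
  unfolding supnorm_def by (rule cSUP_least) (use assms in auto)

lemma supnorm_nonneg:
  assumes "continuous_on {-1..1} \<phi>"
  shows "0 \<le> supnorm \<phi>"
  using abs_le_supnorm[OF assms, of 0] by force

section \<open>Lagrange interpolation\<close>

definition lagrange_basis :: "real set \<Rightarrow> real \<Rightarrow> real poly" where
  "lagrange_basis S x = (\<Prod>y\<in>S - {x}. smult (1 / (x - y)) [:- y, 1:])"

lemma degree_lagrange_basis:
  assumes "finite S" "card S = Suc s" "x \<in> S"
  shows "degree (lagrange_basis S x) \<le> s"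
proof -
  have "degree (lagrange_basis S x) \<le> (\<Sum>y\<in>S - {x}. degree (smult (1 / (x - y)) [:- y, 1:]))"
    unfolding lagrange_basis_def
    using degree_prod_sum_le[of "S - {x}" "\<lambda>y. smult (1 / (x - y)) [:- y, 1:]"] assms(1)
    by (simp add: o_def)
  also have "\<dots> \<le> (\<Sum>y\<in>S - {x}. 1)"
    by (intro sum_mono) auto
  also have "\<dots> = s"
    using assms by simp
  finally show ?thesis .
qed

lemma poly_lagrange_basis:
  assumes "finite S" "x \<in> S" "z \<in> S"
  shows "poly (lagrange_basis S x) z = (if z = x then 1 else 0)"
proof (cases "z = x")
  case True
  then show ?thesis
    by (auto simp: lagrange_basis_def poly_prod diff_divide_distrib[symmetric] intro!: prod.neutral)
next
  case False
  then show ?thesis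
    using assms by (auto simp: lagrange_basis_def poly_prod)
qed

lemma interp_poly_eqI:
  assumes "card S = Suc s" "degree P \<le> s" "\<And>x. x \<in> S \<Longrightarrow> poly P x = \<phi> x"
  shows "interp_poly s S \<phi> = P"
  unfolding interp_poly_def
proof (rule the_equality)
  fix Q assume "degree Q \<le> s \<and> (\<forall>x\<in>S. poly Q x = \<phi> x)"
  then show "Q = P"
    using assms by (intro poly_eqI_degree[of S]) auto
qed (use assms in auto)

lemma
  assumes "card S = Suc s"
  shows interp_poly_lagrange: "interp_poly s S \<phi> = (\<Sum>x\<in>S. smult (\<phi> x) (lagrange_basis S x))"
    and degree_interp_poly: "degree (interp_poly s S \<phi>) \<le> s"
    and poly_interp_poly: "x \<in> S \<Longrightarrow> poly (interp_poly s S \<phi>) x = \<phi> x"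
proof -
  let ?L = "\<Sum>x\<in>S. smult (\<phi> x) (lagrange_basis S x)"
  have fin: "finite S"
    using assms card.infinite by force
  have deg: "degree ?L \<le> s"
    using degree_lagrange_basis[OF fin assms] fin
    by (intro degree_sum_le) (auto intro: order.trans[OF degree_smult_le])
  have val: "poly ?L z = \<phi> z" if "z \<in> S" for z
    using that fin by (simp add: poly_sum poly_lagrange_basis if_distrib cong: if_cong)
  show eq: "interp_poly s S \<phi> = ?L"
    using deg val by (rule interp_poly_eqI[OF assms])
  show "degree (interp_poly s S \<phi>) \<le> s"
    unfolding eq by (rule deg)
  show "poly (interp_poly s S \<phi>) x = \<phi> x" if "x \<in> S"
    unfolding eq by (rule val[OF that])
qed

text \<open>The supremum that defines the operator norm is finite because the Lagrange form bounds it
  by the sum of the norms of the basis polynomials.\<close>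

lemma interp_norm_upper:
  assumes S: "card S = Suc s" "S \<subseteq> {-1..1}"
    and \<phi>: "continuous_on {-1..1} \<phi>" "supnorm \<phi> \<le> 1"
  shows "supnorm (poly (interp_poly s S \<phi>)) \<le> interp_norm s S"
  unfolding interp_norm_def
proof (rule cSUP_upper)
  have "supnorm (poly (interp_poly s S \<psi>)) \<le> (\<Sum>x\<in>S. supnorm (poly (lagrange_basis S x)))"
    if \<psi>: "continuous_on {-1..1} \<psi>" "supnorm \<psi> \<le> 1" for \<psi>
  proof (rule supnorm_le)
    fix t :: real assume t: "t \<in> {-1..1}"
    have "\<bar>poly (interp_poly s S \<psi>) t\<bar> \<le> (\<Sum>x\<in>S. \<bar>\<psi> x\<bar> * \<bar>poly (lagrange_basis S x) t\<bar>)"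
      unfolding interp_poly_lagrange[OF S(1)] poly_sum
      by (rule order.trans[OF sum_abs]) (simp add: abs_mult)
    also have "\<dots> \<le> (\<Sum>x\<in>S. 1 * supnorm (poly (lagrange_basis S x)))"
    proof (intro sum_mono mult_mono)
      fix x assume "x \<in> S"
      then show "\<bar>\<psi> x\<bar> \<le> 1"
        using abs_le_supnorm[OF \<psi>(1), of x] \<psi>(2) S(2) by (meson order.trans subsetD)
      show "\<bar>poly (lagrange_basis S x) t\<bar> \<le> supnorm (poly (lagrange_basis S x))"
        using t by (intro abs_le_supnorm continuous_intros)
    qed auto
    finally show "\<bar>poly (interp_poly s S \<psi>) t\<bar> \<le> (\<Sum>x\<in>S. supnorm (poly (lagrange_basis S x)))"
      by simp
  qed
  then show "bdd_above ((\<lambda>\<phi>. supnorm (poly (interp_poly s S \<phi>))) `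
      {\<phi>. continuous_on {-1..1} \<phi> \<and> supnorm \<phi> \<le> 1})"
    by (intro bdd_aboveI) auto
qed (use \<phi> in simp)

lemma interp_norm_nonneg:
  assumes "card S = Suc s" "S \<subseteq> {-1..1}"
  shows "0 \<le> interp_norm s S"
proof -
  have "0 \<le> supnorm (poly (interp_poly s S (\<lambda>_. 0)))"
    by (intro supnorm_nonneg continuous_intros)
  also have "\<dots> \<le> interp_norm s S"
    using assms by (intro interp_norm_upper supnorm_le) auto
  finally show ?thesis .
qed

text \<open>A polynomial of degree at most \<open>s\<close> reproduces itself under interpolation, so its size on
  \<open>[-1,1]\<close> is controlled by its node values alone. The operator norm is tested on continuous
  functions; clamping the polynomial to \<open>[-M, M]\<close> keeps the node values and gives a continuous
  function of norm at most \<open>M\<close>.\<close>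

lemma abs_poly_le_interp_norm:
  assumes S: "card S = Suc s" "S \<subseteq> {-1..1}"
    and T: "degree T \<le> s" "\<And>x. x \<in> S \<Longrightarrow> \<bar>poly T x\<bar> \<le> M"
    and t: "t \<in> {-1..1}"
  shows "\<bar>poly T t\<bar> \<le> interp_norm s S * M"
proof -
  obtain x0 where "x0 \<in> S"
    using S(1) by fastforce
  then have "0 \<le> M"
    using T(2)[of x0] by linarith
  show ?thesis
  proof (cases "M = 0")
    case True
    then have "T = 0"
      using S(1) T by (intro poly_eqI_degree[of S]) auto
    then show ?thesis
      using True by simp
  next
    case False
    with \<open>0 \<le> M\<close> have M: "0 < M" by simp
    define \<psi> where "\<psi> = (\<lambda>x. max (-1) (min 1 (poly T x / M)))"
    have \<psi>_eq: "poly (smult (1 / M) T) x = \<psi> x" if "x \<in> S" for x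
    proof -
      have "- 1 \<le> poly T x / M" "poly T x / M \<le> 1"
        using T(2)[OF that] M by (auto simp: abs_le_iff field_simps)
      then show ?thesis
        by (simp add: \<psi>_def)
    qed
    have "\<bar>poly (smult (1 / M) T) t\<bar> \<le> supnorm (poly (smult (1 / M) T))"
      using t by (intro abs_le_supnorm continuous_intros)
    also have "smult (1 / M) T = interp_poly s S \<psi>"
      using S(1) T(1) \<psi>_eq by (intro interp_poly_eqI[symmetric]) (auto simp: M)
    also have "supnorm (poly (interp_poly s S \<psi>)) \<le> interp_norm s S"
    proof (rule interp_norm_upper[OF S])
      show "continuous_on {-1..1} \<psi>"
        unfolding \<psi>_def using M by (intro continuous_intros) auto
      show "supnorm \<psi> \<le> 1"
        unfolding \<psi>_def by (intro supnorm_le) (auto simp: max_def min_def)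
    qed
    finally have "\<bar>poly T t\<bar> / M \<le> interp_norm s S"
      using M \<psi>_eq \<open>smult (1 / M) T = interp_poly s S \<psi>\<close>[symmetric] by (simp add: abs_mult)
    then show ?thesis
      using M by (simp add: divide_le_eq)
  qed
qed

section \<open>Weighted discrete least squares\<close>

text \<open>Existence of the orthogonal projection, by Gram--Schmidt: the projection of \<open>g\<close> onto the
  polynomials of degree below \<open>k\<close> is corrected in the direction \<open>C\<close>, which is the component of
  \<open>x^k\<close> orthogonal to them. The form is only semidefinite; if \<open>C\<close> has length zero then \<open>C\<close> vanishes
  wherever the weight does not, so it is orthogonal to everything and the coefficient \<open>c\<close>, then a
  quotient with denominator 0, makes no difference.\<close>

lemma weighted_projection_exists:
  fixes w g :: "real \<Rightarrow> real"
  assumes "finite Y" and w: "\<And>x. x \<in> Y \<Longrightarrow> 0 \<le> w x"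
  shows "\<exists>R. (\<forall>i\<ge>k. coeff R i = 0) \<and>
    (\<forall>Q. (\<forall>i\<ge>k. coeff Q i = 0) \<longrightarrow> (\<Sum>x\<in>Y. w x * (g x - poly R x) * poly Q x) = 0)"
proof (induction k arbitrary: g)
  case 0
  have "(\<forall>i. coeff Q i = 0) \<longleftrightarrow> Q = 0" for Q :: "real poly"
    by (simp add: poly_eq_iff)
  then show ?case
    by (intro exI[of _ 0]) simp
next
  case (Suc k)
  obtain R0 where R0: "\<And>i. i \<ge> k \<Longrightarrow> coeff R0 i = 0"
    "\<And>Q. (\<And>i. i \<ge> k \<Longrightarrow> coeff Q i = 0) \<Longrightarrow> (\<Sum>x\<in>Y. w x * (g x - poly R0 x) * poly Q x) = 0"
    using Suc.IH[of g] by blast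
  obtain Rk where Rk: "\<And>i. i \<ge> k \<Longrightarrow> coeff Rk i = 0"
    "\<And>Q. (\<And>i. i \<ge> k \<Longrightarrow> coeff Q i = 0) \<Longrightarrow>
       (\<Sum>x\<in>Y. w x * (poly (monom 1 k) x - poly Rk x) * poly Q x) = 0"
    using Suc.IH[of "poly (monom 1 k)"] by blast
  define C where "C = monom 1 k - Rk"
  define N where "N = (\<Sum>x\<in>Y. w x * (poly C x)\<^sup>2)"
  define c where "c = (\<Sum>x\<in>Y. w x * (g x - poly R0 x) * poly C x) / N"
  have C_orth: "(\<Sum>x\<in>Y. w x * poly C x * poly Q x) = 0" if "\<And>i. i \<ge> k \<Longrightarrow> coeff Q i = 0" for Q
    using Rk(2)[OF that] by (simp add: C_def)
  have cN: "c * N = (\<Sum>x\<in>Y. w x * (g x - poly R0 x) * poly C x)"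
  proof (cases "N = 0")
    case True
    have "w x * (poly C x)\<^sup>2 = 0" if "x \<in> Y" for x
      using True that w assms(1) unfolding N_def by (subst (asm) sum_nonneg_eq_0_iff) auto
    then have "(\<Sum>x\<in>Y. w x * (g x - poly R0 x) * poly C x) = 0"
      by (intro sum.neutral) auto
    then show ?thesis
      using True by simp
  qed (simp add: c_def)
  show ?case
  proof (intro exI[of _ "R0 + smult c C"] conjI allI impI)
    fix i assume "i \<ge> Suc k"
    then show "coeff (R0 + smult c C) i = 0"
      by (simp add: R0 Rk C_def)
  next
    fix Q :: "real poly" assume Q: "\<forall>i\<ge>Suc k. coeff Q i = 0"
    define a where "a = coeff Q k"
    define Q0 where "Q0 = Q - smult a C"
    have Q0: "coeff Q0 i = 0" if "i \<ge> k" for i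
      using that Q Rk(1) by (cases "i = k") (auto simp: Q0_def a_def C_def)
    have "(\<Sum>x\<in>Y. w x * (g x - poly (R0 + smult c C) x) * poly Q x)
        = (\<Sum>x\<in>Y. w x * (g x - poly R0 x) * poly Q0 x) - c * (\<Sum>x\<in>Y. w x * poly C x * poly Q0 x)
          + a * ((\<Sum>x\<in>Y. w x * (g x - poly R0 x) * poly C x) - c * N)"
      unfolding N_def sum_distrib_left sum_subtractf[symmetric] sum.distrib[symmetric]
      by (intro sum.cong) (auto simp: Q0_def algebra_simps power2_eq_square)
    also have "\<dots> = 0"
      using R0(2)[OF Q0] C_orth[OF Q0] cN by simp
    finally show "(\<Sum>x\<in>Y. w x * (g x - poly (R0 + smult c C) x) * poly Q x) = 0" .
  qed
qed

text \<open>Pythagoras: the excess of any competitor over the projection is its squared distance from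
  the projection, which yields both minimality and uniqueness.\<close>

lemma weighted_least_squares:
  fixes w g :: "real \<Rightarrow> real"
  assumes "finite Y" "\<And>x. x \<in> Y \<Longrightarrow> 0 \<le> w x"
  obtains R where "degree R \<le> p"
    "\<And>Q. degree Q \<le> p \<Longrightarrow> (\<Sum>x\<in>Y. w x * (g x - poly Q x)\<^sup>2)
       = (\<Sum>x\<in>Y. w x * (g x - poly R x)\<^sup>2) + (\<Sum>x\<in>Y. w x * (poly R x - poly Q x)\<^sup>2)"
proof -
  obtain R where R: "\<And>i. i \<ge> Suc p \<Longrightarrow> coeff R i = 0"
    "\<And>Q. (\<And>i. i \<ge> Suc p \<Longrightarrow> coeff Q i = 0) \<Longrightarrow> (\<Sum>x\<in>Y. w x * (g x - poly R x) * poly Q x) = 0"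
    using weighted_projection_exists[where Y = Y and w = w and g = g and k = "Suc p", OF assms] by blast
  show thesis
  proof
    show deg: "degree R \<le> p"
      using R(1) by (intro degree_le) auto
    fix Q :: "real poly" assume "degree Q \<le> p"
    then have "(\<Sum>x\<in>Y. w x * (g x - poly R x) * poly (R - Q) x) = 0"
      using deg by (intro R(2)) (simp add: coeff_eq_0)
    moreover have "(\<Sum>x\<in>Y. w x * (g x - poly Q x)\<^sup>2)
       = (\<Sum>x\<in>Y. w x * (g x - poly R x)\<^sup>2) + (\<Sum>x\<in>Y. w x * (poly R x - poly Q x)\<^sup>2)
         + 2 * (\<Sum>x\<in>Y. w x * (g x - poly R x) * poly (R - Q) x)"
      unfolding sum_distrib_left sum.distrib[symmetric]
      by (intro sum.cong) (auto simp: algebra_simps power2_eq_square)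
    ultimately show "(\<Sum>x\<in>Y. w x * (g x - poly Q x)\<^sup>2)
       = (\<Sum>x\<in>Y. w x * (g x - poly R x)\<^sup>2) + (\<Sum>x\<in>Y. w x * (poly R x - poly Q x)\<^sup>2)"
      by simp
  qed
qed

section \<open>The constrained least-squares polynomial\<close>

definition nodal_poly :: "real set \<Rightarrow> real poly" where
  "nodal_poly S = (\<Prod>x\<in>S. [:- x, 1:])"

lemma poly_nodal_poly: "poly (nodal_poly S) = nodal S"
  by (auto simp: nodal_poly_def nodal_def poly_prod)

lemma degree_nodal_poly: "degree (nodal_poly S) = card S"
  by (simp add: nodal_poly_def degree_prod_eq_sum_degree)

lemma nodal_poly_nonzero: "nodal_poly S \<noteq> 0"
  by (cases "finite S") (auto simp: nodal_poly_def)

lemma nodal_eq_0_iff: "finite S \<Longrightarrow> nodal S t = 0 \<longleftrightarrow> t \<in> S"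
  by (auto simp: nodal_def)

lemma nodal_poly_dvd:
  assumes "finite S" "\<And>x. x \<in> S \<Longrightarrow> poly P x = 0"
  shows "nodal_poly S dvd P"
  using assms
proof (induction S arbitrary: P rule: finite_induct)
  case empty
  then show ?case by (simp add: nodal_poly_def)
next
  case (insert x S)
  then obtain P' where P': "P = [:- x, 1:] * P'"
    by (metis insertI1 poly_eq_0_iff_dvd dvdE)
  have "poly P' z = 0" if "z \<in> S" for z
    using insert.prems[of z] insert.hyps that unfolding P' by auto
  then have "nodal_poly S dvd P'"
    by (rule insert.IH)
  then show ?case
    unfolding P' nodal_poly_def prod.insert[OF insert.hyps] by (intro mult_dvd_mono dvd_refl)
qed

lemma constrained_polys_eq:
  assumes X': "card X' = Suc m"
  shows "constrained_polys (m + p + 1) X' f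
    = (\<lambda>Q. interp_poly m X' f + nodal_poly X' * Q) ` {Q. degree Q \<le> p}"
proof -
  define P0 where "P0 = interp_poly m X' f"
  define \<Omega> where "\<Omega> = nodal_poly X'"
  have fin: "finite X'"
    using X' card.infinite by force
  have P0: "degree P0 \<le> m" "\<And>x. x \<in> X' \<Longrightarrow> poly P0 x = f x"
    unfolding P0_def by (simp_all add: degree_interp_poly[OF X'] poly_interp_poly[OF X'])
  have \<Omega>: "degree \<Omega> = Suc m" "\<Omega> \<noteq> 0"
    by (simp_all add: \<Omega>_def degree_nodal_poly X' nodal_poly_nonzero)
  have "P \<in> (\<lambda>Q. P0 + \<Omega> * Q) ` {Q. degree Q \<le> p}"
    if "degree P \<le> m + p + 1" "\<And>x. x \<in> X' \<Longrightarrow> poly P x = f x" for P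
  proof -
    have "\<Omega> dvd P - P0"
      unfolding \<Omega>_def using that P0 by (intro nodal_poly_dvd[OF fin]) auto
    then obtain Q where Q: "P - P0 = \<Omega> * Q" ..
    have "degree Q \<le> p"
    proof (cases "Q = 0")
      case False
      have "degree (\<Omega> * Q) \<le> m + p + 1"
        unfolding Q[symmetric] using that P0 by (intro degree_diff_le) auto
      then show ?thesis
        using False \<Omega> by (simp add: degree_mult_eq)
    qed simp
    moreover have "P = P0 + \<Omega> * Q"
      using Q by (simp add: algebra_simps)
    ultimately show ?thesis by blast
  qed
  moreover have "degree (P0 + \<Omega> * Q) \<le> m + p + 1" if "degree Q \<le> p" for Q
    using that P0 \<Omega> by (intro degree_add_le order.trans[OF degree_mult_le]) auto
  moreover have "poly (P0 + \<Omega> * Q) x = f x" if "x \<in> X'" for Q x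
    using that P0 by (simp add: \<Omega>_def poly_nodal_poly nodal_eq_0_iff[OF fin])
  ultimately show ?thesis
    unfolding constrained_polys_def P0_def[symmetric] \<Omega>_def[symmetric] by blast
qed

text \<open>Dividing out the interpolation conditions turns the constrained problem for \<open>f\<close> into an
  unconstrained one for the quotient of \<open>f - P\<close> by \<open>nodal X'\<close>, with weights \<open>(nodal X' x)\<^sup>2\<close>. The
  minimizer is unique because the free factor has degree at most \<open>p\<close> and is determined at more than
  \<open>p\<close> points of positive weight.\<close>

lemma cmcls_decomposition:
  assumes X': "card X' = Suc m"
    and X'': "finite X''" "X'' \<inter> X' = {}" "Suc p \<le> card X''"
  obtains R where "degree R \<le> p"
    "cmcls (m + p + 1) X' X'' f = interp_poly m X' f + nodal_poly X' * R"
    "\<And>Q. degree Q \<le> p \<Longrightarrow>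
       (\<Sum>x\<in>X''. (nodal X' x)\<^sup>2 * (f_hat m X' f x - poly R x)\<^sup>2)
       \<le> (\<Sum>x\<in>X''. (nodal X' x)\<^sup>2 * (f_hat m X' f x - poly Q x)\<^sup>2)"
proof -
  let ?w = "\<lambda>x. (nodal X' x)\<^sup>2" and ?g = "f_hat m X' f"
  let ?P = "\<lambda>Q. interp_poly m X' f + nodal_poly X' * Q"
  let ?E = "\<lambda>P. \<Sum>x\<in>X''. (f x - poly P x)\<^sup>2"
  have fin: "finite X'"
    using X' card.infinite by force
  obtain R where R: "degree R \<le> p"
    "\<And>Q. degree Q \<le> p \<Longrightarrow> (\<Sum>x\<in>X''. ?w x * (?g x - poly Q x)\<^sup>2)
       = (\<Sum>x\<in>X''. ?w x * (?g x - poly R x)\<^sup>2) + (\<Sum>x\<in>X''. ?w x * (poly R x - poly Q x)\<^sup>2)"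
    using weighted_least_squares[OF X''(1), of ?w p ?g] by auto
  have E: "?E (?P Q) = (\<Sum>x\<in>X''. ?w x * (?g x - poly Q x)\<^sup>2)" for Q
  proof (rule sum.cong)
    fix x assume "x \<in> X''"
    then have "x \<notin> X'" and "nodal X' x \<noteq> 0"
      using X''(2) nodal_eq_0_iff[OF fin] by auto
    then have "f x - poly (?P Q) x = nodal X' x * (?g x - poly Q x)"
      by (simp add: f_hat_def poly_nodal_poly field_simps)
    then show "(f x - poly (?P Q) x)\<^sup>2 = ?w x * (?g x - poly Q x)\<^sup>2"
      by (simp add: power_mult_distrib)
  qed simp
  have excess: "?E (?P Q) = ?E (?P R) + (\<Sum>x\<in>X''. ?w x * (poly R x - poly Q x)\<^sup>2)"
    if "degree Q \<le> p" for Q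
    using R(2)[OF that] by (simp only: E)
  have le: "?E (?P R) \<le> ?E (?P Q)" if "degree Q \<le> p" for Q
    unfolding excess[OF that] by (simp add: sum_nonneg)
  have "cmcls (m + p + 1) X' X'' f = ?P R"
    unfolding cmcls_def is_arg_min_def constrained_polys_eq[OF X']
  proof (rule the_equality)
    show "?P R \<in> ?P ` {Q. degree Q \<le> p} \<and> (\<nexists>P. P \<in> ?P ` {Q. degree Q \<le> p} \<and> ?E P < ?E (?P R))"
      using R(1) le by (auto simp: not_less)
  next
    fix P assume P: "P \<in> ?P ` {Q. degree Q \<le> p} \<and> (\<nexists>P'. P' \<in> ?P ` {Q. degree Q \<le> p} \<and> ?E P' < ?E P)"
    then obtain Q where Q: "degree Q \<le> p" "P = ?P Q" by blast
    have "?P R \<in> ?P ` {Q. degree Q \<le> p}"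
      using R(1) by (intro imageI) simp
    then have "\<not> ?E (?P R) < ?E P"
      using conjunct2[OF P] by (meson conjI exI)
    then have "(\<Sum>x\<in>X''. ?w x * (poly R x - poly Q x)\<^sup>2) \<le> 0"
      unfolding Q(2) excess[OF Q(1)] by linarith
    then have "(\<Sum>x\<in>X''. ?w x * (poly R x - poly Q x)\<^sup>2) = 0"
      by (intro antisym sum_nonneg) auto
    then have "\<forall>x\<in>X''. ?w x * (poly R x - poly Q x)\<^sup>2 = 0"
      using X''(1) by (subst (asm) sum_nonneg_eq_0_iff) auto
    then have "poly Q x = poly R x" if "x \<in> X''" for x
      using that X''(2) nodal_eq_0_iff[OF fin] by fastforce
    then have "Q = R"
      using X''(3) Q(1) R(1) by (intro poly_eqI_degree[of X'']) auto
    then show "P = ?P R"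
      using Q(2) by simp
  qed
  moreover have "(\<Sum>x\<in>X''. ?w x * (?g x - poly R x)\<^sup>2) \<le> (\<Sum>x\<in>X''. ?w x * (?g x - poly Q x)\<^sup>2)"
    if "degree Q \<le> p" for Q
    using le[OF that] by (simp only: E)
  ultimately show thesis
    using that R(1) by blast
qed

section \<open>Continuity of the quotient\<close>

text \<open>At a node \<open>t\<close> the numerator vanishes, so its quotient by the factor \<open>s - t\<close> of the nodal
  polynomial tends to the derivative of the numerator; the other factors stay away from 0.\<close>

lemma f_hat_continuous:
  assumes f: "f differentiable_on {-1..1}"
    and X': "card X' = Suc m" "X' \<subseteq> {-1..1}"
  shows "continuous_on {-1..1} (f_hat m X' f)"
proof -
  define h where "h = (\<lambda>s. f s - poly (interp_poly m X' f) s)"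
  define g where "g = (\<lambda>s. h s / nodal X' s)"
  have fin: "finite X'"
    using X'(1) card.infinite by force
  have f_hat: "f_hat m X' f t = (if t \<in> X' then Lim (at t within {-1..1}) g else g t)" for t
    by (simp add: f_hat_def g_def h_def)
  have h_zero: "h x = 0" if "x \<in> X'" for x
    using that by (simp add: h_def poly_interp_poly[OF X'(1)])
  have h_diff: "h differentiable (at t within {-1..1})" if "t \<in> {-1..1}" for t
    unfolding h_def using f that
    by (intro differentiable_diff) (auto simp: differentiable_on_def intro: differentiable_at_withinI)
  have g_lim: "(g \<longlongrightarrow> f_hat m X' f t) (at t within {-1..1})" if t: "t \<in> {-1..1}" for t
  proof (cases "t \<in> X'")
    case False
    have "continuous (at t within {-1..1}) h"
      by (rule differentiable_imp_continuous_within[OF h_diff[OF t]])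
    then have "(h \<longlongrightarrow> h t) (at t within {-1..1})"
      by (simp add: continuous_within)
    moreover have "(nodal X' \<longlongrightarrow> nodal X' t) (at t within {-1..1})"
      unfolding nodal_def by (intro tendsto_intros)
    ultimately have "(g \<longlongrightarrow> g t) (at t within {-1..1})"
      unfolding g_def using False nodal_eq_0_iff[OF fin] by (intro tendsto_divide) auto
    then show ?thesis
      using False by (simp add: f_hat)
  next
    case True
    obtain h' where "(h has_field_derivative h') (at t within {-1..1})"
      using h_diff[OF t] real_differentiable_def by blast
    then have "((\<lambda>s. h s / (s - t)) \<longlongrightarrow> h') (at t within {-1..1})"
      using True by (simp add: has_field_derivative_iff h_zero)
    moreover have "(nodal (X' - {t}) \<longlongrightarrow> nodal (X' - {t}) t) (at t within {-1..1})"
      unfolding nodal_def by (intro tendsto_intros)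
    ultimately have "((\<lambda>s. h s / (s - t) / nodal (X' - {t}) s) \<longlongrightarrow> h' / nodal (X' - {t}) t)
        (at t within {-1..1})"
      using nodal_eq_0_iff[of "X' - {t}" t] fin by (intro tendsto_divide) auto
    moreover have "(\<lambda>s. h s / (s - t) / nodal (X' - {t}) s) = g"
      using fin True by (auto simp: g_def nodal_def prod.remove[of X' t])
    ultimately have "(g \<longlongrightarrow> h' / nodal (X' - {t}) t) (at t within {-1..1})"
      by simp
    moreover from this have "Lim (at t within {-1..1}) g = h' / nodal (X' - {t}) t"
      using t by (intro tendsto_Lim) (auto simp: trivial_limit_within)
    ultimately show ?thesis
      using True by (simp add: f_hat)
  qed
  have "(f_hat m X' f \<longlongrightarrow> f_hat m X' f t) (at t within {-1..1})" if t: "t \<in> {-1..1}" for t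
  proof (rule Lim_transform_eventually[OF g_lim[OF t]])
    have "open (- (X' - {t}))"
      using fin by (intro open_Compl finite_imp_closed finite_Diff)
    then have "eventually (\<lambda>s. s \<in> - (X' - {t})) (nhds t)"
      by (rule eventually_nhds_in_open) simp
    then show "eventually (\<lambda>s. g s = f_hat m X' f s) (at t within {-1..1})"
      unfolding eventually_at_filter by eventually_elim (auto simp: f_hat)
  qed
  then show ?thesis
    by (simp add: continuous_on_def)
qed

section \<open>Error of the least-squares approximation\<close>

text \<open>The distance from \<open>R\<close> to \<open>Q\<close> is read off at the nodes in \<open>S\<close>. There \<open>R\<close> is close to \<open>g\<close>
  because one weighted residual is at most the root of the whole sum of squares, which is no larger
  for \<open>R\<close> than for \<open>Q\<close>.\<close>

lemma least_squares_uniform_error: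
  fixes w g :: "real \<Rightarrow> real"
  assumes g: "continuous_on {-1..1} g"
    and Y: "finite Y" "Y \<subseteq> {-1..1}" "\<And>x. x \<in> Y \<Longrightarrow> 0 \<le> w x"
    and S: "card S = Suc p" "S \<subseteq> Y" "\<And>x. x \<in> S \<Longrightarrow> 0 < w x"
    and R: "degree R \<le> p" and Q: "degree Q \<le> p"
    and le: "(\<Sum>x\<in>Y. w x * (g x - poly R x)\<^sup>2) \<le> (\<Sum>x\<in>Y. w x * (g x - poly Q x)\<^sup>2)"
    and t: "t \<in> {-1..1}"
  shows "\<bar>g t - poly R t\<bar>
    \<le> (1 + interp_norm p S * (1 + sqrt (\<Sum>x\<in>Y. w x) / Min ((\<lambda>x. sqrt (w x)) ` S)))
       * supnorm (\<lambda>t. g t - poly Q t)"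
proof -
  define e where "e = supnorm (\<lambda>t. g t - poly Q t)"
  define W where "W = (\<Sum>x\<in>Y. w x)"
  define \<mu> where "\<mu> = Min ((\<lambda>x. sqrt (w x)) ` S)"
  have e: "\<bar>g x - poly Q x\<bar> \<le> e" if "x \<in> {-1..1}" for x
    unfolding e_def using that g by (intro abs_le_supnorm continuous_intros)
  then have "0 \<le> e" by force
  have finS: "finite S" "S \<noteq> {}"
    using S(1) card.infinite by force+
  have "0 < \<mu>"
    unfolding \<mu>_def using finS S(3) by (subst Min_gr_iff) auto
  have \<mu>_le: "\<mu> \<le> sqrt (w x)" if "x \<in> S" for x
    unfolding \<mu>_def using finS that by (intro Min_le) auto
  have "\<bar>poly (R - Q) x\<bar> \<le> (1 + sqrt W / \<mu>) * e" if x: "x \<in> S" for x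
  proof -
    have xY: "x \<in> Y" "x \<in> {-1..1}"
      using x S(2) Y(2) by auto
    have "w x * (g x - poly R x)\<^sup>2 \<le> (\<Sum>x\<in>Y. w x * (g x - poly R x)\<^sup>2)"
      using xY Y by (intro member_le_sum) auto
    also note le
    also have "(\<Sum>x\<in>Y. w x * (g x - poly Q x)\<^sup>2) \<le> (\<Sum>x\<in>Y. w x * e\<^sup>2)"
      using Y e by (intro sum_mono mult_left_mono abs_le_square_iff[THEN iffD1]) (auto simp: \<open>0 \<le> e\<close>)
    also have "\<dots> = W * e\<^sup>2"
      by (simp add: W_def sum_distrib_right)
    finally have "sqrt (w x * (g x - poly R x)\<^sup>2) \<le> sqrt (W * e\<^sup>2)"
      by (rule real_sqrt_le_mono)
    then have "sqrt (w x) * \<bar>g x - poly R x\<bar> \<le> sqrt W * e"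
      using \<open>0 \<le> e\<close> by (simp add: real_sqrt_mult)
    moreover have "\<mu> * \<bar>g x - poly R x\<bar> \<le> sqrt (w x) * \<bar>g x - poly R x\<bar>"
      using \<mu>_le[OF x] by (intro mult_right_mono) auto
    ultimately have "\<bar>g x - poly R x\<bar> \<le> sqrt W / \<mu> * e"
      using \<open>0 < \<mu>\<close> by (simp add: pos_le_divide_eq mult.commute)
    then show ?thesis
      using e[OF xY(2)] by (simp add: algebra_simps)
  qed
  then have "\<bar>poly (R - Q) t\<bar> \<le> interp_norm p S * ((1 + sqrt W / \<mu>) * e)"
    using R Q S Y(2) t by (intro abs_poly_le_interp_norm degree_diff_le) auto
  then show ?thesis
    using e[OF t] unfolding e_def[symmetric] W_def[symmetric] \<mu>_def[symmetric]
    by (simp add: algebra_simps)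
qed

text \<open>At the points of \<open>X'\<close> both the error and \<open>nodal X'\<close> vanish, so the factorization of the error
  holds on all of \<open>[-1,1]\<close>. The factor in front is positive, so the bound for each competitor passes to the
  infimum over competitors.\<close>

lemma cmcls_error_bound:
  assumes f: "f differentiable_on {-1..1}"
    and X': "card X' = Suc m" "X' \<subseteq> {-1..1}"
    and X'': "finite X''" "X'' \<subseteq> {-1..1}" "X'' \<inter> X' = {}"
    and S: "card S = Suc p" "S \<subseteq> X''"
  shows "supnorm (\<lambda>t. f t - poly (cmcls (m + p + 1) X' X'' f) t)
    \<le> (1 + interp_norm p S * (1 + sqrt (\<Sum>x\<in>X''. (nodal X' x)\<^sup>2)
          / Min ((\<lambda>x. sqrt ((nodal X' x)\<^sup>2)) ` S)))
      * best_approx_err p (f_hat m X' f) * supnorm (nodal X')"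
proof -
  define g where "g = f_hat m X' f"
  define A where "A = 1 + interp_norm p S * (1 + sqrt (\<Sum>x\<in>X''. (nodal X' x)\<^sup>2)
          / Min ((\<lambda>x. sqrt ((nodal X' x)\<^sup>2)) ` S))"
  have fin: "finite X'" "finite S" "S \<noteq> {}"
    using X'(1) S(1) card.infinite by force+
  have g: "continuous_on {-1..1} g"
    unfolding g_def by (rule f_hat_continuous[OF f X'])
  have w_pos: "0 < (nodal X' x)\<^sup>2" if "x \<in> S" for x
    using that S(2) X''(3) nodal_eq_0_iff[OF fin(1), of x] by auto
  have "Suc p \<le> card X''"
    using card_mono[OF X''(1) S(2)] S(1) by simp
  then obtain R where R: "degree R \<le> p"
    "cmcls (m + p + 1) X' X'' f = interp_poly m X' f + nodal_poly X' * R"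
    "\<And>Q. degree Q \<le> p \<Longrightarrow> (\<Sum>x\<in>X''. (nodal X' x)\<^sup>2 * (g x - poly R x)\<^sup>2)
       \<le> (\<Sum>x\<in>X''. (nodal X' x)\<^sup>2 * (g x - poly Q x)\<^sup>2)"
    unfolding g_def by (rule cmcls_decomposition[OF X'(1) X''(1,3), where f = f]) blast
  have "0 < Min ((\<lambda>x. sqrt ((nodal X' x)\<^sup>2)) ` S)"
    using fin w_pos by (subst Min_gr_iff) auto
  then have "0 < A"
    unfolding A_def using interp_norm_nonneg[OF S(1)] S(2) X''(2)
    by (intro add_pos_nonneg mult_nonneg_nonneg add_nonneg_nonneg divide_nonneg_nonneg) (auto intro: sum_nonneg)
  have E: "\<bar>g t - poly R t\<bar> \<le> A * best_approx_err p g" if t: "t \<in> {-1..1}" for t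
  proof -
    have "\<bar>g t - poly R t\<bar> / A \<le> best_approx_err p g"
      unfolding best_approx_err_def
    proof (rule cINF_greatest)
      show "{Q :: real poly. degree Q \<le> p} \<noteq> {}"
        by (auto intro: exI[of _ 0])
      fix Q :: "real poly" assume "Q \<in> {Q. degree Q \<le> p}"
      then have "\<bar>g t - poly R t\<bar> \<le> A * supnorm (\<lambda>t. g t - poly Q t)"
        unfolding A_def using w_pos R(1,3) t
        by (intro least_squares_uniform_error[OF g X''(1,2) _ S]) auto
      then show "\<bar>g t - poly R t\<bar> / A \<le> supnorm (\<lambda>t. g t - poly Q t)"
        using \<open>0 < A\<close> by (simp add: divide_le_eq mult.commute)
    qed
    then show ?thesis
      using \<open>0 < A\<close> by (simp add: divide_le_eq mult.commute)
  qed
  have "\<bar>f t - poly (cmcls (m + p + 1) X' X'' f) t\<bar> \<le> A * best_approx_err p g * supnorm (nodal X')"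
    if t: "t \<in> {-1..1}" for t
  proof -
    have "f t - poly (cmcls (m + p + 1) X' X'' f) t = (g t - poly R t) * nodal X' t"
    proof (cases "t \<in> X'")
      case True
      then show ?thesis
        unfolding R(2) using nodal_eq_0_iff[OF fin(1), of t]
        by (simp add: poly_nodal_poly poly_interp_poly[OF X'(1)])
    next
      case False
      then show ?thesis
        unfolding R(2) using nodal_eq_0_iff[OF fin(1), of t]
        by (simp add: g_def f_hat_def poly_nodal_poly field_simps)
    qed
    moreover have "\<bar>nodal X' t\<bar> \<le> supnorm (nodal X')"
      using t unfolding poly_nodal_poly[symmetric] by (intro abs_le_supnorm continuous_intros)
    ultimately show ?thesis
      using E[OF t] by (simp add: abs_mult mult_mono')
  qed
  then show ?thesis
    unfolding A_def[symmetric] g_def[symmetric] by (rule supnorm_le)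
qed

section \<open>The mock-Chebyshev configuration\<close>

text \<open>If \<open>p\<close> were 0, the smoothness class would contain non-differentiable functions, for which the
  quotient need not be bounded. But with \<open>a = \<pi> / \<surd>2\<close>, \<open>m < n\<close> means \<open>a \<surd>n < n\<close>, that is
  \<open>n > a\<^sup>2\<close>, so \<open>a\<^sup>2 n / 6 > a\<^sup>4 / 6 > 1\<close>; here \<open>\<pi> > 3\<close> suffices.\<close>

lemma mock_p_pos:
  assumes "mock_m n < n"
  shows "0 < mock_p n"
proof -
  define a where "a = pi / sqrt 2"
  have a2: "a\<^sup>2 > 9/2"
  proof -
    have "3\<^sup>2 < pi\<^sup>2"
      using pi_gt3 by (intro power_strict_mono) auto
    then show ?thesis
      by (simp add: a_def power_divide)
  qed
  have "a > 0" by (simp add: a_def)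
  have "\<lfloor>a * sqrt n\<rfloor> < int n"
    using assms unfolding mock_m_def a_def[symmetric] by linarith
  then have "a * sqrt n < sqrt n * sqrt n"
    by (simp add: floor_less_iff)
  then have "a < sqrt n"
    by (rule mult_right_less_imp_less) simp
  then have "a\<^sup>2 < (sqrt n)\<^sup>2"
    using \<open>a > 0\<close> by (intro power_strict_mono) auto
  then have "9/2 < real n"
    using a2 by simp
  then have "(9/2) * (9/2 / 6) \<le> a\<^sup>2 * (real n / 6)"
    using a2 by (intro mult_mono) auto
  then have "1\<^sup>2 \<le> (a * sqrt (real n / 6))\<^sup>2"
    by (simp add: power_mult_distrib)
  then have "1 \<le> a * sqrt (real n / 6)"
    using \<open>a > 0\<close> by (rule_tac power2_le_imp_le) auto
  then show ?thesis
    unfolding mock_p_def a_def[symmetric] by (simp add: le_floor_iff zero_less_nat_eq)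
qed

lemma approx_nodes_card:
  assumes "approx_nodes \<delta> X I z Y"
  shows "card Y = card I" "Y \<subseteq> X"
  using assms by (auto simp: approx_nodes_def card_image strict_mono_on_imp_inj_on)

lemma mock_chebyshev_card:
  assumes "mock_chebyshev X m X'"
  shows "card X' = Suc m" "X' \<subseteq> X"
  using assms by (auto simp: mock_chebyshev_def card_image strict_mono_on_imp_inj_on)

lemma equi_nodes_subset: "equi_nodes n \<subseteq> {-1..1}"
  by (auto simp: equi_nodes_def divide_le_eq)

theorem theorem5p2:
  fixes d :: real and p :: nat
  assumes "d > 0"
  shows "\<exists>D :: real. \<forall>(n :: nat) (m :: nat) (q :: nat) X X' X'' Xt X''' (\<delta> :: real) (\<epsilon> :: real) f.
     m = mock_m n \<longrightarrow> q = mock_q n \<longrightarrow> p = mock_p n \<longrightarrow> m < n \<longrightarrow>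
     X = equi_nodes n \<longrightarrow>
     mock_chebyshev X m X' \<longrightarrow>
     X'' = X - X' \<longrightarrow>
     approx_nodes \<delta> X'' {1..q} (mid_grid q) Xt \<longrightarrow>
     approx_nodes \<epsilon> Xt {0..p} (cheb_lobatto p) X''' \<longrightarrow>
     f \<in> F_class d p \<longrightarrow>
     supnorm (\<lambda>t. f t - poly (cmcls (m + p + 1) X' X'' f) t)
       \<le> (1 + interp_norm p X''' *
             (1 + D * (sqrt (\<Sum>x\<in>X''. (nodal X' x)\<^sup>2)
                        / Min ((\<lambda>x. sqrt ((nodal X' x)\<^sup>2)) ` X'''))
                    * (real p + 1) powi (- int p)))
         * best_approx_err p (f_hat m X' f) * supnorm (nodal X')"
proof (intro exI[of _ "(real p + 1) ^ p"] allI impI, goal_cases)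
  case (1 n m q X X' X'' Xt X''' \<delta> \<epsilon> f)
  have D: "(real p + 1) ^ p * K * (real p + 1) powi (- int p) = K" for K :: real
    by (simp add: power_int_minus)
  have "0 < p"
    using 1(1,3,4) mock_p_pos by simp
  have X: "finite X" "X \<subseteq> {-1..1}"
    using equi_nodes_subset 1(5) by (auto simp: equi_nodes_def)
  note X' = mock_chebyshev_card[OF 1(6)]
  show ?case
    unfolding D
  proof (rule cmcls_error_bound)
    show "f differentiable_on {-1..1}"
      using 1(10) \<open>0 < p\<close> unfolding F_class_def C_k_def
      by (metis (mono_tags, lifting) deriv_iter.simps(1) mem_Collect_eq)
    show "card X' = Suc m" "X' \<subseteq> {-1..1}"
      using X' X(2) by blast+
    show "finite X''" "X'' \<subseteq> {-1..1}" "X'' \<inter> X' = {}"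
      unfolding 1(7) using X by blast+
    show "card X''' = Suc p" "X''' \<subseteq> X''"
      using approx_nodes_card[OF 1(8)] approx_nodes_card[OF 1(9)] by auto
  qed
qed

end
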